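(* Let $\mathrm{SPoA}(d)$ be the (asymptotic) strong price of anarchy of the selfish $d$-hypercube bin packing game. There is an absolute constant $d_0$ such that for all $d\geq d_0$ we have $\mathrm{SPoA}(d)\geq \log d$.
   Context: Selfish $d$-hypercube bin packing game: a game $G$ consists of a finite set of $d$-dimensional hypercubes (the players/items), each of side length at most $1$, to be packed into unit bins $[0,1]^d$ (axis-parallel, pairwise non-overlapping within a bin). A configuration is a feasible assignment of the items to bins. The cost of an item is its volume divided by the total volume of the items in its bin. A configuration is a strong Nash equilibrium if there is no group (coalition) of items that can simultaneously change bins, while all other items stay in their bins, so that the resulting assignment is feasible (every bin's contents can be packed into a unit bin) and every member of the group strictly decreases its cost. The social cost ${\rm SC}(p)$ of a configuration $p$ is the number of used bins and ${\rm OPT}(G)$ is the minimum social cost. Writing $\mathcal{SN}(G)$ for the set of strong Nash equilibria of $G$ and $\mathcal{G}_d$ for the class of all such games with $d$-dimensional items, $\mathrm{SPoA}(d)=\limsup_{m\to\infty}\sup_{G\in\mathcal{G}_d,\,{\rm OPT}(G)=m}\max_{p\in\mathcal{SN}(G)}{\rm SC}(p)/m$. Here $\log$ is the natural logarithm. *)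

theory Defs
  imports Complex_Main "HOL-Library.FuncSet" "HOL-Library.Extended_Real"
begin

text \<open>A game is the list of the side lengths of its items; the players are the indices of the list,
  so several players may have cubes of the same size. The dimension is a separate parameter.\<close>

type_synonym game = "real list"

definition is_game :: "game \<Rightarrow> bool" where
  "is_game G \<longleftrightarrow> (\<forall>s\<in>set G. 0 < s \<and> s \<le> 1)"

definition items :: "game \<Rightarrow> nat set" where
  "items G = {..<length G}"

definition closed_cube :: "nat \<Rightarrow> (nat \<Rightarrow> real) \<Rightarrow> real \<Rightarrow> (nat \<Rightarrow> real) set" where
  "closed_cube d x s = (\<Pi>\<^sub>E k\<in>{..<d}. {x k .. x k + s})"

definition open_cube :: "nat \<Rightarrow> (nat \<Rightarrow> real) \<Rightarrow> real \<Rightarrow> (nat \<Rightarrow> real) set" where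
  "open_cube d x s = (\<Pi>\<^sub>E k\<in>{..<d}. {x k <..< x k + s})"

text \<open>Here \<open>x i\<close> is the corner of item \<open>i\<close> with the smallest coordinates.
  Items in a bin may touch, but their interiors are disjoint.\<close>

definition packable :: "nat \<Rightarrow> game \<Rightarrow> nat set \<Rightarrow> bool" where
  "packable d G S \<longleftrightarrow>
     (\<exists>x :: nat \<Rightarrow> nat \<Rightarrow> real.
        (\<forall>i\<in>S. closed_cube d (x i) (G ! i) \<subseteq> closed_cube d (\<lambda>_. 0) 1) \<and>
        (\<forall>i\<in>S. \<forall>j\<in>S. i \<noteq> j \<longrightarrow>
           open_cube d (x i) (G ! i) \<inter> open_cube d (x j) (G ! j) = {}))"

text \<open>Bins are labelled by natural numbers, so empty bins are always available.
  The values of an assignment outside the items are irrelevant.\<close>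

definition bin :: "game \<Rightarrow> (nat \<Rightarrow> nat) \<Rightarrow> nat \<Rightarrow> nat set" where
  "bin G p b = {i \<in> items G. p i = b}"

definition configuration :: "nat \<Rightarrow> game \<Rightarrow> (nat \<Rightarrow> nat) \<Rightarrow> bool" where
  "configuration d G p \<longleftrightarrow> (\<forall>b. packable d G (bin G p b))"

definition vol :: "nat \<Rightarrow> game \<Rightarrow> nat \<Rightarrow> real" where
  "vol d G i = (G ! i) ^ d"

definition cost :: "nat \<Rightarrow> game \<Rightarrow> (nat \<Rightarrow> nat) \<Rightarrow> nat \<Rightarrow> real" where
  "cost d G p i = vol d G i / (\<Sum>j\<in>bin G p (p i). vol d G j)"

definition improving_deviation ::
    "nat \<Rightarrow> game \<Rightarrow> (nat \<Rightarrow> nat) \<Rightarrow> nat set \<Rightarrow> (nat \<Rightarrow> nat) \<Rightarrow> bool" where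
  "improving_deviation d G p C p' \<longleftrightarrow>
     C \<noteq> {} \<and> C \<subseteq> items G \<and>
     (\<forall>i\<in>C. p' i \<noteq> p i) \<and>
     (\<forall>i\<in>items G - C. p' i = p i) \<and>
     configuration d G p' \<and>
     (\<forall>i\<in>C. cost d G p' i < cost d G p i)"

definition SN :: "nat \<Rightarrow> game \<Rightarrow> (nat \<Rightarrow> nat) set" where
  "SN d G = {p. configuration d G p \<and> \<not> (\<exists>C p'. improving_deviation d G p C p')}"

definition SC :: "game \<Rightarrow> (nat \<Rightarrow> nat) \<Rightarrow> nat" where
  "SC G p = card (p ` items G)"

definition OPT :: "nat \<Rightarrow> game \<Rightarrow> nat" where
  "OPT d G = (LEAST m. \<exists>p. configuration d G p \<and> SC G p = m)"

text \<open>The inner supremum ranges over finitely many values (at most the number of items), so it is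
  a maximum whenever a strong Nash equilibrium exists.\<close>

definition SPoA :: "nat \<Rightarrow> ereal" where
  "SPoA d = limsup (\<lambda>m::nat.
     SUP G \<in> {G. is_game G \<and> OPT d G = m}.
       SUP p \<in> SN d G. ereal (real (SC G p) / real m))"

end

theory Submission
  imports Defs "HOL-Library.Nat_Bijection"
begin

text \<open>
  Fix a large \<open>K\<close> and use items of type \<open>j = 1, \<dots>, K\<close> with side \<open>(1 + 2\<^sup>-\<^sup>K) / 2\<^sup>j\<close>. An item of
  type \<open>j < l\<close> can be cut into items of type \<open>l\<close> and at most \<open>(2\<^sup>l - 1)\<^sup>d\<close> of the latter fit
  into a bin, so a bin with \<open>(2\<^sup>l - 1)\<^sup>d\<close> items of type \<open>l\<close> has the largest possible volume
  among all bins with types at most \<open>l\<close>. Hence a configuration consisting only of such full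
  homogeneous bins is a strong Nash equilibrium: consider an item of the largest type in a
  deviating coalition.

  On the other hand one bin can hold \<open>(2\<^sup>j - 1)\<^sup>d - (2\<^sup>j - 2)\<^sup>d\<close> items of every type \<open>j\<close> at the
  same time: the items of types below \<open>j\<close> fill a cube of side \<open>2\<^sup>j - 2\<close>, measured in items of
  type \<open>j\<close>, which is enlarged by a layer of type \<open>j\<close> to a cube of side \<open>2\<^sup>j - 1\<close>. The ratio of
  the two numbers of bins is \<open>\<Sum>j=1..K. 1 - (1 - 1 / (2\<^sup>j - 1))\<^sup>d\<close>, which is close to \<open>K\<close> as long
  as \<open>2\<^sup>K\<close> is a small fraction of \<open>d\<close>; so it is about \<open>log\<^sub>2 d\<close>, beating the natural logarithm.
\<close>

section \<open>Packings aligned to dyadic grids\<close>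

text \<open>Slightly more than \<open>1 / 2 ^ j\<close>, so that \<open>2 ^ j\<close> items do not
  fit side by side, but so little that \<open>2 ^ j - 1\<close> items do, for every
  \<open>j \<le> K\<close> at once.\<close>

definition side :: "nat \<Rightarrow> nat \<Rightarrow> real" where
  "side K j = (1 + 1 / 2 ^ K) / 2 ^ j"

text \<open>Grid positions of corners, measured in units of \<open>side K j\<close>.\<close>

definition cells :: "nat \<Rightarrow> nat \<Rightarrow> (nat \<Rightarrow> nat) set" where
  "cells d j = (\<Pi>\<^sub>E k\<in>{..<d}. {..<2 ^ j - 1})"

text \<open>For \<open>j \<ge> 1\<close> this is the last layer: the cells with some coordinate
  equal to \<open>2 ^ j - 2\<close>.\<close>

definition rim :: "nat \<Rightarrow> nat \<Rightarrow> (nat \<Rightarrow> nat) set" where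
  "rim d j = cells d j - (\<Pi>\<^sub>E k\<in>{..<d}. {..<2 ^ j - 2})"

lemma side_pos: "0 < side K j"
  by (auto simp: side_def intro!: divide_pos_pos add_pos_pos)

lemma side_gt: "1 / 2 ^ j < side K j"
  by (simp add: side_def divide_strict_right_mono)

lemma side_le_1: assumes "1 \<le> j" shows "side K j \<le> 1"
proof -
  have "(2::real) \<le> 2 ^ j" using assms power_increasing[of 1 j "2::real"] by simp
  moreover have "1 + 1 / 2 ^ K \<le> (2::real)" by simp
  ultimately have "1 + 1 / 2 ^ K \<le> (2::real) ^ j" by linarith
  then show ?thesis by (simp add: side_def)
qed

lemma side_scale: assumes "j \<le> J" shows "side K j = 2 ^ (J - j) * side K J"
  using assms by (simp add: side_def power_diff)

lemma finite_cells: "finite (cells d j)"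
  unfolding cells_def by (intro finite_PiE) auto

lemma card_cells: "card (cells d j) = (2 ^ j - 1) ^ d"
  unfolding cells_def by (subst card_PiE) auto

lemma rim_subset: "rim d j \<subseteq> cells d j"
  by (auto simp: rim_def)

lemma card_rim: "card (rim d j) = (2 ^ j - 1) ^ d - (2 ^ j - 2) ^ d"
proof -
  have "(\<Pi>\<^sub>E k\<in>{..<d}. {..<2 ^ j - 2}) \<subseteq> cells d j"
    unfolding cells_def by (intro PiE_mono) auto
  then show ?thesis
    unfolding rim_def by (subst card_Diff_subset) (auto simp: card_cells card_PiE finite_PiE)
qed

lemma packableI:
  assumes inside: "\<And>i k. i \<in> S \<Longrightarrow> k < d \<Longrightarrow> 0 \<le> x i k \<and> x i k + G ! i \<le> 1"
    and apart: "\<And>i j. i \<in> S \<Longrightarrow> j \<in> S \<Longrightarrow> i \<noteq> j \<Longrightarrow>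
      \<exists>k<d. x i k + G ! i \<le> x j k \<or> x j k + G ! j \<le> x i k"
  shows "packable d G S"
  unfolding packable_def
proof (intro exI[of _ x] conjI ballI impI)
  fix i assume "i \<in> S"
  then show "closed_cube d (x i) (G ! i) \<subseteq> closed_cube d (\<lambda>_. 0) 1"
    unfolding closed_cube_def using inside by (intro PiE_mono) fastforce
next
  fix i j assume "i \<in> S" "j \<in> S" "i \<noteq> j"
  from apart[OF this] obtain k where k: "k < d"
    "x i k + G ! i \<le> x j k \<or> x j k + G ! j \<le> x i k" by blast
  show "open_cube d (x i) (G ! i) \<inter> open_cube d (x j) (G ! j) = {}"
  proof (rule equals0I)
    fix y assume "y \<in> open_cube d (x i) (G ! i) \<inter> open_cube d (x j) (G ! j)"
    then have "y k \<in> {x i k<..<x i k + G ! i}" "y k \<in> {x j k<..<x j k + G ! j}"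
      using k(1) by (auto simp: open_cube_def dest!: PiE_mem)
    then show False using k(2) by auto
  qed
qed

text \<open>Cells of level \<open>j\<close> fill \<open>[0, (2 ^ j - 1) * side K j]\<close>, and every cell of the rim of a higher
  level has a coordinate beyond that interval.\<close>

lemma packable_cells:
  assumes inj: "inj_on h S"
    and h: "\<And>i. i \<in> S \<Longrightarrow> fst (h i) \<le> K \<and> snd (h i) \<in> cells d (fst (h i)) \<and> G ! i = side K (fst (h i))"
    and rim: "\<And>i j. i \<in> S \<Longrightarrow> j \<in> S \<Longrightarrow> fst (h i) < fst (h j) \<Longrightarrow> snd (h j) \<in> rim d (fst (h j))"
  shows "packable d G S"
proof (rule packableI)
  let ?x = "\<lambda>i k. real (snd (h i) k) * side K (fst (h i))"
  have end_le: "?x i k + G ! i \<le> (2 ^ fst (h i) - 1) * side K (fst (h i))" if "i \<in> S" "k < d" for i k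
  proof -
    have "snd (h i) k < 2 ^ fst (h i) - 1"
      using h[OF that(1)] that(2) by (auto simp: cells_def)
    then have "real (snd (h i) k + 1) \<le> real (2 ^ fst (h i) - 1)" by linarith
    then have "real (snd (h i) k) + 1 \<le> 2 ^ fst (h i) - 1" by simp
    from mult_right_mono[OF this less_imp_le[OF side_pos[of K "fst (h i)"]]]
    show ?thesis using h[OF that(1)] by (simp add: algebra_simps)
  qed
  show "0 \<le> ?x i k \<and> ?x i k + G ! i \<le> 1" if "i \<in> S" "k < d" for i k
  proof
    show "0 \<le> ?x i k" using less_imp_le[OF side_pos] by auto
    let ?j = "fst (h i)"
    have "(2::real) ^ ?j \<le> 2 ^ K" using h[OF that(1)] by (intro power_increasing) auto
    \<comment> \<open>Clearing denominators in \<open>(2 ^ ?j - 1) * side K ?j \<le> 1\<close>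
      leaves exactly this inequality.\<close>
    then have "(2::real) ^ ?j \<le> 1 + 2 ^ K" by linarith
    then have "(2 ^ ?j - 1) * side K ?j \<le> 1"
      unfolding side_def by (simp add: field_simps)
    then show "?x i k + G ! i \<le> 1" using end_le[OF that] by linarith
  qed
  have below: "\<exists>k<d. ?x i k + G ! i \<le> ?x j k"
    if ij: "i \<in> S" "j \<in> S" "fst (h i) < fst (h j)" for i j
  proof -
    let ?a = "fst (h i)" and ?b = "fst (h j)"
    have "snd (h j) \<in> rim d ?b" using rim[OF ij] .
    then obtain k where k: "k < d" "\<not> snd (h j) k < 2 ^ ?b - 2"
      by (fastforce simp: rim_def cells_def PiE_iff)
    \<comment> \<open>Both positions compared below carry the factor \<open>1 + 1 / 2 ^ K\<close>.
      Without it, the end of level \<open>?a\<close> precedes the last layer of level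
      \<open>?b\<close> because \<open>?a + 1 \<le> ?b\<close>.\<close>
    have "(2::real) ^ (?a + 1) \<le> 2 ^ ?b" using ij(3) by (intro power_increasing) auto
    then have *: "1 - 1 / 2 ^ ?a \<le> 1 - 2 / (2::real) ^ ?b" by (simp add: field_simps)
    have "(2::nat) ^ 1 \<le> 2 ^ ?b" using ij(3) by (intro power_increasing) auto
    then have "real (2 ^ ?b - 2) = 2 ^ ?b - 2" by simp
    moreover have "real (2 ^ ?b - 2) \<le> real (snd (h j) k)" using k(2) by linarith
    ultimately have "(2 ^ ?b - 2) * side K ?b \<le> ?x j k"
      by (intro mult_right_mono) (auto simp: side_pos less_imp_le)
    moreover have "(2 ^ ?a - 1) * side K ?a = (1 - 1 / 2 ^ ?a) * (1 + 1 / 2 ^ K)"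
      "(2 ^ ?b - 2) * side K ?b = (1 - 2 / 2 ^ ?b) * (1 + 1 / 2 ^ K)"
      by (simp_all add: side_def field_simps)
    moreover have "(1 - 1 / 2 ^ ?a) * (1 + 1 / 2 ^ K) \<le> (1 - 2 / 2 ^ ?b) * (1 + 1 / (2::real) ^ K)"
      using * by (intro mult_right_mono) auto
    ultimately have "?x i k + G ! i \<le> ?x j k" using end_le[OF ij(1) k(1)] by linarith
    then show ?thesis using k(1) by blast
  qed
  show "\<exists>k<d. ?x i k + G ! i \<le> ?x j k \<or> ?x j k + G ! j \<le> ?x i k"
    if ij: "i \<in> S" "j \<in> S" "i \<noteq> j" for i j
  proof (cases "fst (h i) = fst (h j)")
    case True
    let ?a = "fst (h i)"
    have "snd (h i) \<noteq> snd (h j)"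
      using inj ij True by (metis inj_onD prod.expand)
    then obtain k where k: "k < d" "snd (h i) k \<noteq> snd (h j) k"
      using h[OF ij(1)] h[OF ij(2)] True unfolding cells_def by (metis PiE_ext lessThan_iff)
    have step: "real u * side K ?a + side K ?a \<le> real v * side K ?a" if "u < v" for u v
    proof -
      have "(real u + 1) * side K ?a \<le> real v * side K ?a"
        using that by (intro mult_right_mono) (auto simp: side_pos less_imp_le)
      then show ?thesis by (simp add: algebra_simps)
    qed
    from k(2) consider "snd (h i) k < snd (h j) k" | "snd (h j) k < snd (h i) k" by linarith
    then show ?thesis
      using step k(1) h[OF ij(1)] h[OF ij(2)] True by cases (metis, metis)
  next
    case False
    then consider "fst (h i) < fst (h j)" | "fst (h j) < fst (h i)" by linarith
    then show ?thesis using below ij by cases blast+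
  qed
qed

text \<open>With a single level the rim condition of \<open>packable_cells\<close> is vacuous, so
  any injection into the cells is a packing.\<close>

lemma packable_homogeneous:
  assumes "finite S" "card S \<le> (2 ^ j - 1) ^ d" "j \<le> K" "\<And>i. i \<in> S \<Longrightarrow> G ! i = side K j"
  shows "packable d G S"
proof -
  obtain c where c: "c ` S \<subseteq> cells d j" "inj_on c S"
    using card_le_inj[OF assms(1) finite_cells[of d j]] assms(2) by (auto simp: card_cells)
  show ?thesis
    by (rule packable_cells[of "\<lambda>i. (j, c i)"]) (use c assms(3,4) in \<open>auto simp: inj_on_def\<close>)
qed

section \<open>Volume bound for a bin by counting grid points\<close>

lemma card_grid_interval:
  fixes x s :: real
  assumes "0 \<le> x" "x + s \<le> 1" "real M / real N < s" "0 < N"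
  shows "M \<le> card {t \<in> {1..<N}. x < real t / real N \<and> real t / real N < x + s}" (is "_ \<le> card ?T")
proof -
  define u where "u = nat \<lfloor>x * N\<rfloor>"
  have u: "real u \<le> x * N" "x * N < real u + 1"
    using assms(1) by (auto simp: u_def)
  have M: "real M < s * N" using assms(3,4) by (simp add: field_simps)
  have le: "(x + s) * N \<le> N" using assms(2,4) by simp
  \<comment> \<open>The \<open>M\<close> grid points following \<open>x\<close> lie inside the open
    interval because its length strictly exceeds \<open>M / N\<close>.\<close>
  have "{u + 1..u + M} \<subseteq> ?T"
  proof
    fix t assume t: "t \<in> {u + 1..u + M}"
    then have "real u + 1 \<le> real t" "real t \<le> real u + real M" by auto
    then have "x * N < t" "t < (x + s) * N" using u M by (auto simp: algebra_simps)
    moreover from this(2) have "t < N" using le by simp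
    ultimately show "t \<in> ?T" using t assms(4) by (auto simp: field_simps)
  qed
  then have "card {u + 1..u + M} \<le> card ?T" by (intro card_mono) auto
  then show ?thesis by simp
qed

text \<open>An item of type \<open>j \<le> J\<close> in the unit cube contains at least \<open>2 ^ (d * (J - j))\<close> of the
  \<open>(2 ^ J - 1) ^ d\<close> interior points of the grid with spacing \<open>1 / 2 ^ J\<close>, and its volume is
  \<open>2 ^ (d * (J - j)) * side K J ^ d\<close>.\<close>

lemma packable_volume_le:
  assumes "finite S" "packable d G S"
    and ty: "\<And>i. i \<in> S \<Longrightarrow> ty i \<le> J \<and> G ! i = side K (ty i)"
  shows "(\<Sum>i\<in>S. vol d G i) \<le> real ((2 ^ J - 1) ^ d) * side K J ^ d"
proof -
  obtain x where inside: "\<And>i. i \<in> S \<Longrightarrow> closed_cube d (x i) (G ! i) \<subseteq> closed_cube d (\<lambda>_. 0) 1"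
    and disj: "\<And>i j. i \<in> S \<Longrightarrow> j \<in> S \<Longrightarrow> i \<noteq> j \<Longrightarrow>
      open_cube d (x i) (G ! i) \<inter> open_cube d (x j) (G ! j) = {}"
    using assms(2) unfolding packable_def by blast
  define I where "I i k = {t \<in> {1..<2 ^ J}. x i k < real t / real (2 ^ J) \<and>
    real t / real (2 ^ J) < x i k + G ! i}" for i k
  define Q where "Q i = (\<Pi>\<^sub>E k\<in>{..<d}. I i k)" for i
  have finI: "finite (I i k)" for i k by (auto simp: I_def)
  have bounds: "0 \<le> x i k" "x i k + G ! i \<le> 1" if "i \<in> S" "k < d" for i k
  proof -
    have pos: "0 < G ! i" using ty[OF that(1)] side_pos by simp
    \<comment> \<open>Inclusion of products passes to the factors only for a nonempty product, hence
      the positivity of the side.\<close>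
    have "\<forall>k<d. {x i k..x i k + G ! i} \<subseteq> {0..0 + 1}"
      using inside[OF that(1)] pos unfolding closed_cube_def
      by (auto simp: subset_PiE PiE_eq_empty_iff)
    then show "0 \<le> x i k" "x i k + G ! i \<le> 1" using that(2) pos by auto
  qed
  have card_Q: "(2 ^ (J - ty i)) ^ d \<le> card (Q i)" if i: "i \<in> S" for i
  proof -
    have "2 ^ (J - ty i) \<le> card (I i k)" if k: "k < d" for k
      unfolding I_def
    proof (rule card_grid_interval)
      have "(2::real) ^ (J - ty i) / 2 ^ J = 1 / 2 ^ ty i"
        using ty[OF i] by (simp add: power_diff)
      then show "real (2 ^ (J - ty i)) / real (2 ^ J) < G ! i"
        using ty[OF i] side_gt[of "ty i" K] by simp
    qed (use bounds[OF i k] in auto)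
    then have "(\<Prod>k<d. 2 ^ (J - ty i)) \<le> (\<Prod>k<d. card (I i k))"
      by (intro prod_mono) auto
    then show ?thesis by (simp add: Q_def card_PiE)
  qed
  \<comment> \<open>After rescaling, a common index would be a common point of two disjoint open
    cubes.\<close>
  have Q_disj: "Q i \<inter> Q j = {}" if "i \<in> S" "j \<in> S" "i \<noteq> j" for i j
  proof (rule equals0I)
    fix t assume t: "t \<in> Q i \<inter> Q j"
    have "(\<lambda>k\<in>{..<d}. real (t k) / real (2 ^ J)) \<in> open_cube d (x l) (G ! l)" if "t \<in> Q l" for l
      using that by (auto simp: Q_def I_def open_cube_def PiE_iff)
    then show False using t disj[OF that] by blast
  qed
  have "(\<Sum>i\<in>S. (2 ^ (J - ty i)) ^ d) \<le> (\<Sum>i\<in>S. card (Q i))"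
    by (intro sum_mono card_Q)
  also have "\<dots> = card (\<Union>i\<in>S. Q i)"
    using Q_disj assms(1) by (intro card_UN_disjoint[symmetric]) (auto simp: Q_def finI finite_PiE)
  also have "\<dots> \<le> card (\<Pi>\<^sub>E k\<in>{..<d}. {1..<(2::nat) ^ J})"
  proof (intro card_mono UN_least)
    show "Q i \<subseteq> (\<Pi>\<^sub>E k\<in>{..<d}. {1..<2 ^ J})" for i
      unfolding Q_def by (intro PiE_mono) (auto simp: I_def)
  qed (simp add: finite_PiE)
  also have "\<dots> = (2 ^ J - 1) ^ d" by (simp add: card_PiE)
  finally have count: "real (\<Sum>i\<in>S. (2 ^ (J - ty i)) ^ d) \<le> real ((2 ^ J - 1) ^ d)"
    by (simp only: of_nat_le_iff)
  have "(\<Sum>i\<in>S. vol d G i) = real (\<Sum>i\<in>S. (2 ^ (J - ty i)) ^ d) * side K J ^ d"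
    unfolding of_nat_sum sum_distrib_right vol_def
  proof (intro sum.cong refl)
    fix i assume "i \<in> S"
    then have "G ! i = 2 ^ (J - ty i) * side K J" using ty side_scale by metis
    then show "(G ! i) ^ d = real ((2 ^ (J - ty i)) ^ d) * side K J ^ d"
      by (simp add: power_mult_distrib)
  qed
  also have "\<dots> \<le> real ((2 ^ J - 1) ^ d) * side K J ^ d"
    using count by (intro mult_right_mono) (auto simp: side_pos less_imp_le)
  finally show ?thesis .
qed

lemma packable_subset: "packable d G S \<Longrightarrow> T \<subseteq> S \<Longrightarrow> packable d G T"
  unfolding packable_def by (erule ex_forward) blast

section \<open>Homogeneous full bins form a strong Nash equilibrium\<close>

lemma exists_maximizer:
  fixes f :: "'a \<Rightarrow> 'b :: linorder"
  assumes "finite A" "A \<noteq> {}"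
  shows "\<exists>x\<in>A. \<forall>y\<in>A. f y \<le> f x"
  using Max_in[of "f ` A"] Max_ge[of "f ` A"] assms by fastforce

lemma finite_bin: "finite (bin G p b)"
  by (simp add: bin_def items_def)

text \<open>Let \<open>i\<close> have the largest type in a coalition and let \<open>B\<close> be
  its new bin. An item of larger type in \<open>B\<close> would have stayed put together with its
  whole old bin, leaving no volume for \<open>i\<close>. Otherwise \<open>packable_volume_le\<close>
  bounds \<open>B\<close> by the volume of the old bin of \<open>i\<close>, so the cost of
  \<open>i\<close> does not drop.\<close>

lemma SN_homogeneous:
  assumes ty: "\<And>i. i \<in> items G \<Longrightarrow> ty i \<le> K \<and> G ! i = side K (ty i)"
    and hom: "\<And>i j. i \<in> items G \<Longrightarrow> j \<in> items G \<Longrightarrow> p i = p j \<Longrightarrow> ty i = ty j"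
    and full: "\<And>i. i \<in> items G \<Longrightarrow> card (bin G p (p i)) = (2 ^ ty i - 1) ^ d"
  shows "p \<in> SN d G"
proof -
  define V where "V J = real ((2 ^ J - 1) ^ d) * side K J ^ d" for J
  have conf: "configuration d G p"
    unfolding configuration_def
  proof
    fix b
    show "packable d G (bin G p b)"
    proof (cases "bin G p b = {}")
      case True then show ?thesis by (simp add: packable_def)
    next
      case False
      then obtain i where i: "i \<in> items G" "p i = b" by (auto simp: bin_def)
      show ?thesis
      proof (rule packable_homogeneous)
        show "card (bin G p b) \<le> (2 ^ ty i - 1) ^ d" using full[OF i(1)] i(2) by simp
        show "ty i \<le> K" using ty[OF i(1)] by simp
        fix j assume "j \<in> bin G p b"
        then have "j \<in> items G" "ty j = ty i" using hom[of j i] i by (simp_all add: bin_def)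
        then show "G ! j = side K (ty i)" using ty by metis
      qed (rule finite_bin)
    qed
  qed
  have volV: "(\<Sum>j\<in>bin G p (p i). vol d G j) = V (ty i)" if i: "i \<in> items G" for i
  proof -
    have "(\<Sum>j\<in>bin G p (p i). vol d G j) = (\<Sum>j\<in>bin G p (p i). side K (ty i) ^ d)"
    proof (intro sum.cong refl)
      fix j assume "j \<in> bin G p (p i)"
      then have "j \<in> items G" "p j = p i" by (auto simp: bin_def)
      then show "vol d G j = side K (ty i) ^ d"
        using ty hom i by (metis vol_def)
    qed
    then show ?thesis by (simp add: V_def full[OF i])
  qed
  have vol_pos: "0 < vol d G i" if "i \<in> items G" for i
    using ty[OF that] side_pos by (simp add: vol_def)
  have "\<not> improving_deviation d G p C p'" for C p'
  proof
    assume "improving_deviation d G p C p'"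
    then have C: "C \<noteq> {}" "C \<subseteq> items G" and stay: "\<And>i. i \<in> items G - C \<Longrightarrow> p' i = p i"
      and conf': "configuration d G p'" and less: "\<And>i. i \<in> C \<Longrightarrow> cost d G p' i < cost d G p i"
      by (auto simp: improving_deviation_def)
    have finC: "finite C" using C(2) by (rule finite_subset) (simp add: items_def)
    obtain i where i: "i \<in> C" and imax: "\<And>j. j \<in> C \<Longrightarrow> ty j \<le> ty i"
      using exists_maximizer[OF finC C(1), of ty] by blast
    define B where "B = bin G p' (p' i)"
    have iG: "i \<in> items G" using i C by blast
    have iB: "i \<in> B" using iG by (simp add: B_def bin_def)
    have finB: "finite B" by (simp add: B_def finite_bin)
    have BG: "B \<subseteq> items G" by (auto simp: B_def bin_def)
    have packB: "packable d G B" using conf' by (simp add: configuration_def B_def)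
    have volB: "(\<Sum>j\<in>B. vol d G j) \<le> V J" if "\<And>j. j \<in> B \<Longrightarrow> ty j \<le> J" for J
      unfolding V_def using finB packB
      by (rule packable_volume_le[where ty = ty]) (use that ty BG in auto)
    have small: "ty j \<le> ty i" if "j \<in> B" for j
    proof (rule ccontr)
      assume "\<not> ty j \<le> ty i"
      \<comment> \<open>Maximality of \<open>ty l\<close> in \<open>B\<close> lets
        \<open>volB\<close> bound all of \<open>B\<close> by the volume of the old bin of
        \<open>l\<close> alone.\<close>
      obtain l where l: "l \<in> B" and lmax: "\<And>j. j \<in> B \<Longrightarrow> ty j \<le> ty l"
        using exists_maximizer[OF finB, of ty] iB by blast
      have tl: "ty i < ty l" using lmax[OF that] \<open>\<not> ty j \<le> ty i\<close> by linarith
      have lG: "l \<in> items G" using l BG by blast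
      have "l \<notin> C" using imax tl by force
      then have pl: "p l = p' i" using stay lG l by (auto simp: B_def bin_def)
      have sub: "bin G p (p l) \<subseteq> B"
      proof
        fix j assume "j \<in> bin G p (p l)"
        then have j: "j \<in> items G" "p j = p l" by (auto simp: bin_def)
        then have "ty j = ty l" using hom lG by blast
        then have "j \<notin> C" using imax tl by force
        then show "j \<in> B" using stay j pl by (auto simp: B_def bin_def)
      qed
      have "i \<notin> bin G p (p l)" using hom[OF iG lG] tl by (auto simp: bin_def)
      then have "V (ty l) + vol d G i = (\<Sum>j\<in>insert i (bin G p (p l)). vol d G j)"
        using volV[OF lG] by (simp add: finite_bin)
      also have "\<dots> \<le> (\<Sum>j\<in>B. vol d G j)"
        using sub iB finB BG vol_pos by (intro sum_mono2) (auto intro: less_imp_le)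
      also have "\<dots> \<le> V (ty l)" by (rule volB) (rule lmax)
      finally show False using vol_pos[OF iG] by simp
    qed
    have "0 < (\<Sum>j\<in>B. vol d G j)"
      using finB iB BG vol_pos by (intro sum_pos) auto
    then have "cost d G p i \<le> cost d G p' i"
      unfolding cost_def volV[OF iG] B_def[symmetric]
      using volB[OF small] vol_pos[OF iG] by (intro divide_left_mono) auto
    then show False using less[OF i] by simp
  qed
  then show ?thesis using conf by (auto simp: SN_def)
qed

section \<open>The game\<close>

text \<open>Number the elements and divide the numbers by \<open>F\<close>; the last block is
  complete because \<open>F\<close> divides \<open>card X\<close>.\<close>

lemma exists_equipartition:
  assumes "finite X" "0 < F" "F dvd card X"
  shows "\<exists>g :: 'a \<Rightarrow> nat. \<forall>x\<in>X. card {y \<in> X. g y = g x} = F"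
proof -
  obtain f where f: "bij_betw f X {..<card X}"
    using ex_bij_betw_finite_nat[OF assms(1)] by (auto simp: atLeast0LessThan)
  obtain q where q: "card X = F * q" using assms(3) by blast
  have "card {y \<in> X. f y div F = f x div F} = F" if "x \<in> X" for x
  proof -
    define r where "r = f x div F"
    have "f x < F * q" using f that q by (auto simp: bij_betw_def)
    then have r: "r < q" using assms(2) by (simp add: r_def less_mult_imp_div_less mult.commute)
    have le: "r * F + F \<le> card X"
    proof -
      have "Suc r * F \<le> q * F" using r by (intro mult_right_mono) auto
      then show ?thesis by (simp add: q algebra_simps)
    qed
    have iff: "t div F = r \<longleftrightarrow> r * F \<le> t \<and> t < r * F + F" for t
    proof -
      have "t div F = r \<longleftrightarrow> r \<le> t div F \<and> t div F < Suc r" by linarith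
      then show ?thesis
        using assms(2)
        by (simp add: less_eq_div_iff_mult_less_eq div_less_iff_less_mult add.commute)
    qed
    have "{t \<in> {..<card X}. t div F = r} = {r * F..<r * F + F}"
      unfolding iff using le by (intro set_eqI) (simp, linarith)
    moreover have "f ` {y \<in> X. f y div F = r} = {t \<in> f ` X. t div F = r}" by blast
    ultimately have "f ` {y \<in> X. f y div F = r} = {r * F..<r * F + F}"
      using f by (simp only: bij_betw_def)
    moreover have "inj_on f {y \<in> X. f y div F = r}"
      using f by (auto simp: bij_betw_def inj_on_def)
    ultimately have "card {y \<in> X. f y div F = r} = card {r * F..<r * F + F}"
      by (metis card_image)
    then show ?thesis by (simp add: r_def)
  qed
  then show ?thesis by (intro exI[of _ "\<lambda>x. f x div F"]) simp
qed

text \<open>The items form \<open>m\<close> copies of one mixed bin. Keeping the copies apart is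
  optimal, while sorting all items by type into full bins gives the equilibrium. Divisibility of
  \<open>m\<close> ensures that no bin of the sorted packing is left partly filled.\<close>

lemma exists_game:
  assumes "1 \<le> d" "1 \<le> K" and dvd: "\<And>j. j \<in> {1..K} \<Longrightarrow> (2 ^ j - 1) ^ d dvd m"
  shows "\<exists>G p. is_game G \<and> OPT d G = m \<and> p \<in> SN d G \<and>
    real m * (\<Sum>j=1..K. real (card (rim d j)) / real ((2 ^ j - 1) ^ d)) \<le> real (SC G p)"
proof -
  \<comment> \<open>\<open>D\<close> lists the contents of one mixed bin as pairs of a type and a
    rim cell; the first component in \<open>X\<close> is the number of the copy.\<close>
  define D where "D = Sigma {1..K} (rim d)"
  define X where "X = {..<m} \<times> D"
  have fin_rim: "finite (rim d j)" for j using finite_subset[OF rim_subset finite_cells] .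
  have finX: "finite X" by (auto simp: X_def D_def fin_rim)
  define n where "n = card X"
  obtain e where e: "bij_betw e {..<n} X"
    using ex_bij_betw_nat_finite[OF finX] by (auto simp: atLeast0LessThan n_def)
  define ty where "ty i = fst (snd (e i))" for i
  define G where "G = map (\<lambda>i. side K (ty i)) [0..<n]"
  have items: "items G = {..<n}" by (simp add: items_def G_def)
  have eX: "e i \<in> X" if "i < n" for i using e that by (auto simp: bij_betw_def)
  have ty: "1 \<le> ty i \<and> ty i \<le> K \<and> G ! i = side K (ty i)" if "i < n" for i
    using eX[OF that] that by (auto simp: X_def D_def ty_def G_def)
  have game: "is_game G"
    using ty by (auto simp: is_game_def G_def side_pos intro!: side_le_1)
  define Y where "Y j = {i. i < n \<and> ty i = j}" for j
  have cardY: "card (Y j) = m * card (rim d j)" if j: "j \<in> {1..K}" for j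
  proof -
    have "e ` Y j = {..<m} \<times> ({j} \<times> rim d j)"
    proof
      show "e ` Y j \<subseteq> {..<m} \<times> ({j} \<times> rim d j)"
        using eX by (fastforce simp: Y_def ty_def X_def D_def)
      show "{..<m} \<times> ({j} \<times> rim d j) \<subseteq> e ` Y j"
      proof
        fix z assume z: "z \<in> {..<m} \<times> ({j} \<times> rim d j)"
        then have "z \<in> X" using j by (auto simp: X_def D_def)
        then obtain i where "i < n" "z = e i" using e by (auto simp: bij_betw_def)
        then show "z \<in> e ` Y j" using z by (auto simp: Y_def ty_def)
      qed
    qed
    moreover have "inj_on e (Y j)" using e by (auto simp: bij_betw_def inj_on_def Y_def)
    ultimately have "card (Y j) = card ({..<m} \<times> ({j} \<times> rim d j))" by (metis card_image)
    then show ?thesis by (simp add: card_cartesian_product)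
  qed
  have finY: "finite (Y j)" for j by (simp add: Y_def)
  have F_pos: "0 < ((2::nat) ^ j - 1) ^ d" if "j \<in> {1..K}" for j
  proof -
    have "(2::nat) ^ 1 \<le> 2 ^ j" using that by (intro power_increasing) auto
    then show ?thesis by simp
  qed

  define q where "q i = fst (e i)" for i
  have q_conf: "configuration d G q"
    unfolding configuration_def
  proof
    fix b
    show "packable d G (bin G q b)"
    proof (rule packable_cells[of "\<lambda>i. snd (e i)"])
      show "inj_on (\<lambda>i. snd (e i)) (bin G q b)"
      proof (rule inj_onI)
        fix i j assume "i \<in> bin G q b" "j \<in> bin G q b" "snd (e i) = snd (e j)"
        then have "i \<in> {..<n}" "j \<in> {..<n}" "e i = e j"
          by (auto simp: bin_def items q_def intro: prod_eqI)
        then show "i = j" using e by (auto simp: bij_betw_def dest: inj_onD)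
      qed
      fix i assume "i \<in> bin G q b"
      then have i: "i < n" by (simp add: bin_def items)
      then show "fst (snd (e i)) \<le> K \<and> snd (snd (e i)) \<in> cells d (fst (snd (e i))) \<and>
          G ! i = side K (fst (snd (e i)))"
        using eX[OF i] ty[OF i] rim_subset by (fastforce simp: X_def D_def ty_def)
    next
      fix j assume "j \<in> bin G q b"
      then have j: "j < n" by (simp add: bin_def items)
      then show "snd (snd (e j)) \<in> rim d (fst (snd (e j)))"
        using eX[OF j] by (auto simp: X_def D_def)
    qed
  qed
  \<comment> \<open>The subtracted term is \<open>0 ^ d\<close>, which vanishes since
    \<open>d \<ge> 1\<close>.\<close>
  have card_rim1: "card (rim d 1) = 1" using assms(1) by (simp add: card_rim power_0_left)
  have q_SC: "SC G q = m"
  proof -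
    obtain c where "c \<in> rim d 1" using card_rim1 by (metis card_1_singletonE insertI1)
    then have "(1, c) \<in> D" using assms(2) by (auto simp: D_def)
    then have "fst ` X = {..<m}" by (auto simp: X_def image_iff)
    moreover have "q ` items G = fst ` e ` {..<n}" by (auto simp: q_def items image_image)
    ultimately have "q ` items G = {..<m}" using e by (simp add: bij_betw_def)
    then show ?thesis by (simp add: SC_def)
  qed
  \<comment> \<open>Each copy contains one item of type 1, and by volume no two of these share a
    bin.\<close>
  have SC_ge: "m \<le> SC G p" if conf: "configuration d G p" for p
  proof -
    have "inj_on p (Y 1)"
    proof (rule inj_onI, rule ccontr)
      fix i j assume ij: "i \<in> Y 1" "j \<in> Y 1" "p i = p j" "i \<noteq> j"
      then have "packable d G {i, j}"
        using conf[unfolded configuration_def, rule_format, of "p i"]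
        by (auto simp: Y_def bin_def items intro: packable_subset)
      then have "(\<Sum>i\<in>{i, j}. vol d G i) \<le> real ((2 ^ 1 - 1) ^ d) * side K 1 ^ d"
        by (intro packable_volume_le[where ty = ty]) (use ij ty in \<open>auto simp: Y_def\<close>)
      moreover have "vol d G i = side K 1 ^ d" "vol d G j = side K 1 ^ d"
        using ij ty by (auto simp: Y_def vol_def)
      ultimately have "side K 1 ^ d \<le> 0" using ij(4) by simp
      moreover have "0 < side K 1 ^ d" using side_pos by simp
      ultimately show False by linarith
    qed
    then have "card (p ` Y 1) = m" using cardY[of 1] assms(2) card_rim1 by (simp add: card_image)
    moreover have "card (p ` Y 1) \<le> SC G p"
      unfolding SC_def by (intro card_mono) (auto simp: items Y_def)
    ultimately show ?thesis by simp
  qed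
  have opt: "OPT d G = m"
    unfolding OPT_def by (rule Least_equality) (use q_conf q_SC SC_ge in auto)

  have "\<exists>g :: nat \<Rightarrow> nat. \<forall>x\<in>Y j. card {y \<in> Y j. g y = g x} = (2 ^ j - 1) ^ d"
    if "j \<in> {1..K}" for j
    by (rule exists_equipartition[OF finY F_pos[OF that]])
      (unfold cardY[OF that], intro dvd_mult2 dvd that)
  then obtain g :: "nat \<Rightarrow> nat \<Rightarrow> nat" where
    g: "\<And>j x. j \<in> {1..K} \<Longrightarrow> x \<in> Y j \<Longrightarrow> card {y \<in> Y j. g j y = g j x} = (2 ^ j - 1) ^ d"
    by metis
  \<comment> \<open>Encoding the type in the label keeps blocks of different types in different
    bins.\<close>
  define p where "p i = prod_encode (ty i, g (ty i) i)" for i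
  have p_bin: "bin G p (p i) = {y \<in> Y (ty i). g (ty i) y = g (ty i) i}" for i
    by (auto simp: bin_def items p_def Y_def)
  have full: "card (bin G p (p i)) = (2 ^ ty i - 1) ^ d" if "i < n" for i
    unfolding p_bin using ty[OF that] that by (intro g) (auto simp: Y_def)
  have p_SN: "p \<in> SN d G"
    by (rule SN_homogeneous[where ty = ty and K = K]) (use ty full in \<open>auto simp: items p_def\<close>)
  have part: "real m * (real (card (rim d j)) / real ((2 ^ j - 1) ^ d)) \<le> real (card (p ` Y j))"
    if j: "j \<in> {1..K}" for j
  proof -
    have "Y j = (\<Union>b\<in>p ` Y j. {i \<in> Y j. p i = b})" by auto
    then have "card (Y j) = card (\<Union>b\<in>p ` Y j. {i \<in> Y j. p i = b})" by (rule arg_cong)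
    also have "\<dots> \<le> (\<Sum>b\<in>p ` Y j. card {i \<in> Y j. p i = b})"
      by (intro card_UN_le finite_imageI finY)
    also have "\<dots> \<le> (\<Sum>b\<in>p ` Y j. (2 ^ j - 1) ^ d)"
    proof (rule sum_mono)
      fix b assume "b \<in> p ` Y j"
      then obtain i where i: "i \<in> Y j" "b = p i" by blast
      have "card {i \<in> Y j. p i = b} \<le> card (bin G p (p i))"
        by (intro card_mono finite_bin) (use i in \<open>auto simp: bin_def items Y_def\<close>)
      then show "card {i \<in> Y j. p i = b} \<le> (2 ^ j - 1) ^ d"
        using full i by (auto simp: Y_def)
    qed
    finally have "m * card (rim d j) \<le> card (p ` Y j) * (2 ^ j - 1) ^ d"
      by (simp add: cardY[OF j])
    then have "real m * real (card (rim d j)) \<le> real (card (p ` Y j)) * real ((2 ^ j - 1) ^ d)"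
      by (metis of_nat_le_iff of_nat_mult)
    then show ?thesis using F_pos[OF j] by (simp only: times_divide_eq_right pos_divide_le_eq of_nat_0_less_iff)
  qed
  have "(\<Sum>j=1..K. card (p ` Y j)) = card (\<Union>j\<in>{1..K}. p ` Y j)"
    by (intro card_UN_disjoint[symmetric]) (auto simp: finY p_def Y_def)
  also have "\<dots> \<le> SC G p"
    unfolding SC_def by (intro card_mono) (auto simp: items Y_def)
  finally have "real (\<Sum>j=1..K. card (p ` Y j)) \<le> real (SC G p)" by (simp only: of_nat_le_iff)
  moreover have "real m * (\<Sum>j=1..K. real (card (rim d j)) / real ((2 ^ j - 1) ^ d))
      \<le> (\<Sum>j=1..K. real (card (p ` Y j)))"
    unfolding sum_distrib_left by (intro sum_mono part)
  ultimately have "real m * (\<Sum>j=1..K. real (card (rim d j)) / real ((2 ^ j - 1) ^ d)) \<le> real (SC G p)"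
    by simp
  then show ?thesis using game opt p_SN by blast
qed

text \<open>\<open>exists_game\<close> applies whenever \<open>m\<close> is a multiple of
  \<open>P\<close>. These multiples form a subsequence, and its limsup is a lower bound for the full
  one.\<close>

lemma SPoA_ge:
  assumes "1 \<le> d" "1 \<le> K"
  shows "ereal (\<Sum>j=1..K. real (card (rim d j)) / real ((2 ^ j - 1) ^ d)) \<le> SPoA d"
proof -
  let ?c = "\<Sum>j=1..K. real (card (rim d j)) / real ((2 ^ j - 1) ^ d)"
  let ?f = "\<lambda>m::nat. SUP G \<in> {G. is_game G \<and> OPT d G = m}.
       SUP p \<in> SN d G. ereal (real (SC G p) / real m)"
  define P where "P = (\<Prod>j=1..K. ((2::nat) ^ j - 1) ^ d)"
  have P_pos: "0 < P"
  proof (unfold P_def, rule prod_pos)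
    fix j assume "j \<in> {1..K}"
    then have "(2::nat) ^ 1 \<le> 2 ^ j" by (intro power_increasing) auto
    then show "0 < ((2::nat) ^ j - 1) ^ d" by simp
  qed
  have "ereal ?c \<le> ?f (P * Suc t)" for t
  proof -
    let ?m = "P * Suc t"
    have "(2 ^ j - 1) ^ d dvd ?m" if "j \<in> {1..K}" for j
      unfolding P_def using that by (intro dvd_mult2 dvd_prodI) auto
    from exists_game[OF assms this] obtain G p where
      Gp: "is_game G" "OPT d G = ?m" "p \<in> SN d G" "real ?m * ?c \<le> real (SC G p)" by blast
    have "0 < real ?m" using P_pos by (simp only: of_nat_0_less_iff) simp
    then have "?c \<le> real (SC G p) / real ?m"
      using Gp(4) by (simp only: pos_le_divide_eq mult.commute)
    then show ?thesis
      using Gp(1-3) by (intro SUP_upper2[of G] SUP_upper2[of p]) auto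
  qed
  then have "ereal ?c \<le> limsup (?f \<circ> (\<lambda>t. P * Suc t))"
    by (intro order_trans[OF _ Liminf_le_Limsup] Liminf_bounded always_eventually allI) auto
  also have "\<dots> \<le> limsup ?f"
    using P_pos by (intro limsup_subseq_mono) (auto simp: strict_mono_def)
  finally show ?thesis by (simp add: SPoA_def)
qed

section \<open>Choice of the number of types\<close>

text \<open>With \<open>a = 2 ^ j - 1 \<le> 2 ^ K\<close> the missing fraction is
  \<open>(1 - 1 / a) ^ d \<le> exp (- d / a) \<le> exp (- 8)\<close>.\<close>

lemma rim_ratio_ge:
  assumes "1 \<le> j" "j \<le> K" "8 * 2 ^ K \<le> d"
  shows "8 / 9 \<le> real (card (rim d j)) / real ((2 ^ j - 1) ^ d)"
proof -
  have j2: "(2::real) \<le> 2 ^ j" using assms(1) power_increasing[of 1 j "2::real"] by simp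
  have j2': "(2::nat) ^ 1 \<le> 2 ^ j" using assms(1) by (intro power_increasing) auto
  have jK: "(2::real) ^ j \<le> 2 ^ K" using assms(2) by (intro power_increasing) auto
  let ?a = "(2::real) ^ j - 1"
  have a: "1 \<le> ?a" "?a \<le> 2 ^ K" using j2 jK by linarith+
  have le: "((2::nat) ^ j - 2) ^ d \<le> (2 ^ j - 1) ^ d" by (intro power_mono) auto
  have "real (card (rim d j)) = ?a ^ d - (?a - 1) ^ d"
    using j2' le by (simp add: card_rim)
  then have "real (card (rim d j)) / real ((2 ^ j - 1) ^ d) = 1 - ((?a - 1) / ?a) ^ d"
  proof -
    have "real ((2 ^ j - 1) ^ d) = ?a ^ d" using j2' by simp
    moreover have "?a ^ d \<noteq> 0" using a by simp
    ultimately have "real (card (rim d j)) / real ((2 ^ j - 1) ^ d) = 1 - (?a - 1) ^ d / ?a ^ d"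
      using \<open>real (card (rim d j)) = _\<close>
      by (simp add: diff_divide_distrib[of "?a ^ d"])
    then show ?thesis by (simp only: power_divide)
  qed
  moreover have "((?a - 1) / ?a) ^ d \<le> 1 / 9"
  proof -
    have "(?a - 1) / ?a = 1 + - (1 / ?a)" using a by (simp add: field_simps)
    also have "\<dots> \<le> exp (- (1 / ?a))" by (rule exp_ge_add_one_self)
    also have "\<dots> \<le> exp (- (1 / 2 ^ K))" using a by (simp add: frac_le)
    finally have "((?a - 1) / ?a) ^ d \<le> exp (- (1 / 2 ^ K)) ^ d"
      using a by (intro power_mono) auto
    also have "\<dots> = exp (- (real d / 2 ^ K))" by (simp flip: exp_of_nat_mult)
    also have "\<dots> \<le> exp (- 8)"
    proof -
      have "real (8 * 2 ^ K) \<le> real d" using assms(3) by (simp only: of_nat_le_iff)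
      then show ?thesis by (simp add: field_simps)
    qed
    \<comment> \<open>The crude bound \<open>exp 8 \<ge> 1 + 8\<close> is enough.\<close>
    also have "\<dots> \<le> 1 / 9"
      using exp_ge_add_one_self[of 8] by (simp add: exp_minus field_simps)
    finally show ?thesis .
  qed
  ultimately show ?thesis by simp
qed

theorem theorem3:
  "\<exists>d0::nat. \<forall>d\<ge>d0. SPoA d \<ge> ereal (ln (real d))"
proof (intro exI[of _ "2 ^ 25"] allI impI)
  fix d :: nat assume d: "2 ^ 25 \<le> d"
  obtain n where n: "2 ^ n \<le> d" "d < 2 ^ (n + 1)"
    using ex_power_ivl1[of 2 d] d by auto
  have "(2::nat) ^ 25 < 2 ^ (n + 1)" using d n(2) by linarith
  then have "25 < n + 1" by (subst (asm) power_strict_increasing_iff) auto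
  \<comment> \<open>Giving up three powers of two secures the factor 8 required by
    \<open>rim_ratio_ge\<close>.\<close>
  define K where "K = n - 3"
  have nK: "n = K + 3" and K: "22 \<le> K" using \<open>25 < n + 1\<close> by (auto simp: K_def)
  have K8: "8 * 2 ^ K \<le> d" using n(1) by (simp add: nK power_add)
  have "d \<le> 2 ^ (K + 4)" using n(2) by (simp add: nK add.commute)
  then have "real d \<le> real (2 ^ (K + 4))" by (simp only: of_nat_le_iff)
  moreover have ln2: "ln 2 \<le> (3 / 4 :: real)"
  proof -
    have "(2::real) \<le> (9 / 8) ^ 6" by (simp add: power_divide)
    also have "\<dots> \<le> exp (1 / 8) ^ 6"
      using exp_ge_add_one_self[of "1 / 8 :: real"] by (intro power_mono) auto
    also have "\<dots> = exp (3 / 4)" by (simp flip: exp_of_nat_mult)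
    finally have "ln 2 \<le> ln (exp (3 / 4 :: real))" by (subst ln_le_cancel_iff) auto
    then show ?thesis by simp
  qed
  ultimately have "ln (real d) \<le> ln (2 ^ (K + 4))" using d by (subst ln_le_cancel_iff) auto
  also have "\<dots> = real (K + 4) * ln 2" by (simp add: ln_realpow)
  also have "\<dots> \<le> real (K + 4) * (3 / 4)"
    using ln2 by (intro mult_left_mono) auto
  \<comment> \<open>The gain \<open>8 / 9 - 3 / 4 = 5 / 36\<close> per type has to absorb
    \<open>4 * (3 / 4) = 3\<close>, which holds from \<open>K = 22\<close> on; this is the source of
    the threshold \<open>2 ^ 25\<close>.\<close>
  also have "\<dots> \<le> real K * (8 / 9)" using K by simp
  also have "\<dots> = (\<Sum>j=1..K. 8 / 9)" by simp
  also have "\<dots> \<le> (\<Sum>j=1..K. real (card (rim d j)) / real ((2 ^ j - 1) ^ d))"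
    by (rule sum_mono, rule rim_ratio_ge[OF _ _ K8]) auto
  finally have "ereal (ln (real d)) \<le> ereal (\<Sum>j=1..K. real (card (rim d j)) / real ((2 ^ j - 1) ^ d))"
    by simp
  also have "\<dots> \<le> SPoA d" using d K by (intro SPoA_ge) auto
  finally show "ereal (ln (real d)) \<le> SPoA d" .
qed

end
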